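(* Let $n\geq 1$. There is a constant $C$ depending only on $n$, and one may take $C=(2\pi e)^{\frac{n}{2}}$, such that the following holds. Let $0<q<r\leq\infty$ and let $f$ be a probability density function on $\mathbb{R}^n$ with $\|f\|_q<\infty$ and finite $q$-covariance matrix $\Sigma_q$. Then $$\frac{1-q}{q}h_q(X)\leq \frac{1-r}{r}h_r(X)+\left(\frac{1}{q}-\frac{1}{r}\right)\left(\frac{1}{2}\log(\det\Sigma_q)+\log C\right).$$
   Context: All integrals are with respect to Lebesgue measure. For $0<p<\infty$, $\|f\|_p=\left(\int_{\mathbb{R}^n}|f(x)|^p\,d^nx\right)^{1/p}$, and $\|f\|_\infty=\operatorname{ess\,sup}_{x\in\mathbb{R}^n}|f(x)|$. The Rényi entropy of order $p$ of a random vector $X$ with density $f$ is $h_p(X)=\frac{p}{1-p}\log\|f\|_p$. For every $0<p\leq\infty$, including $p=1$ and $p=\infty$, the expression $\frac{1-p}{p}h_p(X)$ is understood as $\log\|f\|_p$ (so it equals $0$ for $p=1$), with $\log\infty=+\infty$; $\frac1r$ is $0$ for $r=\infty$. For $q>0$ with $0<\|f\|_q<\infty$, the $q$-expectation is $$E_q[X]=\frac{\int_{\mathbb{R}^n}x|f(x)|^q\,d^nx}{\int_{\mathbb{R}^n}|f(x)|^q\,d^nx},$$ with the analogous formula for functions of $X$ (replace $x$ in the numerator by that function of $x$), and the $q$-covariance matrix is $\Sigma_q=E_q\left[(X-E_q[X])(X-E_q[X])^T\right]$. It is called finite when $\int_{\mathbb{R}^n}|x|^2|f(x)|^q\,d^nx<\infty$.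 *)

theory Defs
  imports "HOL-Probability.Essential_Supremum"
begin

definition prob_density :: "(real ^ 'n \<Rightarrow> real) \<Rightarrow> bool" where
  "prob_density f \<longleftrightarrow>
     f \<in> borel_measurable lebesgue \<and> (AE x in lebesgue. 0 \<le> f x) \<and>
     (\<integral>\<^sup>+ x. ennreal (f x) \<partial>lebesgue) = 1"

text \<open>Exponents range over \<^typ>\<open>ereal\<close> so that \<open>p = \<infinity>\<close> is allowed (and \<open>1 / p = 0\<close> there);
  only \<open>p > 0\<close> is meaningful. Norms are extended: they may be \<open>\<infinity>\<close>. The libraries
  provide no real powers on \<^typ>\<open>ennreal\<close>, hence the case distinction.\<close>

definition Lp_norm :: "ereal \<Rightarrow> (real ^ 'n \<Rightarrow> real) \<Rightarrow> ennreal" where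
  "Lp_norm p f =
     (if p = \<infinity> then esssup lebesgue (\<lambda>x. ennreal \<bar>f x\<bar>)
      else let I = (\<integral>\<^sup>+ x. ennreal (\<bar>f x\<bar> powr real_of_ereal p) \<partial>lebesgue)
           in if I = \<infinity> then \<infinity> else ennreal (enn2real I powr (1 / real_of_ereal p)))"

definition ext_log :: "ennreal \<Rightarrow> ereal" where
  "ext_log a = (if a = 0 then -\<infinity> else if a = \<infinity> then \<infinity> else ereal (ln (enn2real a)))"

text \<open>The Renyi entropy \<open>h\<^sub>p\<close> of a random vector with density \<open>f\<close>, for \<open>0 < p < \<infinity>\<close>, \<open>p \<noteq> 1\<close>.\<close>

definition renyi_entropy :: "real \<Rightarrow> (real ^ 'n \<Rightarrow> real) \<Rightarrow> ereal" where
  "renyi_entropy p f = ereal (p / (1 - p)) * ext_log (Lp_norm (ereal p) f)"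

text \<open>The expression \<open>((1 - p) / p) h\<^sub>p\<close>, which by convention means \<open>log \<parallel>f\<parallel>\<^sub>p\<close> for all
  \<open>0 < p \<le> \<infinity>\<close>, including \<open>p = 1\<close> and \<open>p = \<infinity>\<close>; the lemmas below show that this agrees with
  the literal product wherever \<open>h\<^sub>p\<close> is defined, and is \<open>0\<close> for a density at \<open>p = 1\<close>.\<close>

definition scaled_renyi_entropy :: "ereal \<Rightarrow> (real ^ 'n \<Rightarrow> real) \<Rightarrow> ereal" where
  "scaled_renyi_entropy p f = ext_log (Lp_norm p f)"

lemma scaled_renyi_entropy_eq:
  assumes "0 < p" "p \<noteq> 1"
  shows "scaled_renyi_entropy (ereal p) f = ereal ((1 - p) / p) * renyi_entropy p f"
proof -
  have "ereal ((1 - p) / p) * ereal (p / (1 - p)) = 1"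
    using assms by (simp add: one_ereal_def)
  then show ?thesis
    unfolding scaled_renyi_entropy_def renyi_entropy_def
    by (metis mult.assoc mult_1)
qed

lemma scaled_renyi_entropy_1:
  assumes "prob_density f"
  shows "scaled_renyi_entropy 1 f = 0"
proof -
  have "(\<integral>\<^sup>+ x. ennreal (\<bar>f x\<bar> powr 1) \<partial>lebesgue) = (\<integral>\<^sup>+ x. ennreal (f x) \<partial>lebesgue)"
    using assms by (intro nn_integral_cong_AE) (auto simp: prob_density_def)
  with assms show ?thesis
    by (simp add: scaled_renyi_entropy_def Lp_norm_def ext_log_def prob_density_def)
qed

text \<open>The \<open>q\<close>-expectation of \<open>g X\<close>, where \<open>X\<close> has density \<open>f\<close>; \<open>g\<close> may be scalar, vector or
  matrix valued.\<close>

definition q_expectation ::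
  "real \<Rightarrow> (real ^ 'n \<Rightarrow> real) \<Rightarrow> (real ^ 'n \<Rightarrow> 'b::{banach, second_countable_topology}) \<Rightarrow> 'b"
where
  "q_expectation q f g =
     (\<integral>x. (\<bar>f x\<bar> powr q) *\<^sub>R g x \<partial>lebesgue) /\<^sub>R (\<integral>x. \<bar>f x\<bar> powr q \<partial>lebesgue)"

definition q_covariance :: "real \<Rightarrow> (real ^ 'n \<Rightarrow> real) \<Rightarrow> real ^ 'n ^ 'n" where
  "q_covariance q f =
     (let m = q_expectation q f (\<lambda>x. x)
      in q_expectation q f (\<lambda>x. columnvector (x - m) ** transpose (columnvector (x - m) :: real ^ 1 ^ 'n)))"

definition finite_q_covariance :: "real \<Rightarrow> (real ^ 'n \<Rightarrow> real) \<Rightarrow> bool" where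
  "finite_q_covariance q f \<longleftrightarrow>
     (\<integral>\<^sup>+ x. ennreal ((norm x)\<^sup>2 * \<bar>f x\<bar> powr q) \<partial>lebesgue) < \<infinity>"

end

theory Submission
  imports Defs "HOL-Probability.Distributions"
begin

text \<open>The density \<open>g = \<bar>f\<bar>\<^sup>q / \<integral>\<bar>f\<bar>\<^sup>q\<close> has covariance matrix \<open>\<Sigma>\<^sub>q\<close>, so by the Gaussian maximum
  entropy principle its differential entropy is at most \<open>K = log (det \<Sigma>\<^sub>q) / 2 + log C\<close>. Jensen's
  inequality turns this into \<open>\<integral>g\<^bsup>1+s\<^esup> \<ge> exp (- s K)\<close> for \<open>s > 0\<close>; with \<open>s = r / q - 1\<close> (or \<open>s = 1\<close>
  and \<open>g \<le> \<parallel>f\<parallel>\<^sub>\<infinity>\<^sup>q / \<integral>\<bar>f\<bar>\<^sup>q\<close> if \<open>r = \<infinity>\<close>) and after taking logarithms this is the claim. Both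
  steps are merged into one pointwise lower bound for \<open>g\<^bsup>1+s\<^esup>\<close> involving the Gaussian density \<open>\<phi>\<close> with
  the same covariance, so that the integrability of \<open>g log g\<close> never has to be discussed.\<close>

section \<open>Linear change of variables for Lebesgue measure\<close>

text \<open>By Tonelli the coordinate along \<open>i\<close> may be integrated first. With the other
  coordinates frozen, the shear moves it by the constant \<open>x \<bullet> j\<close>, because
  \<open>i \<noteq> j\<close>, and one-dimensional Lebesgue measure is translation
  invariant.\<close>

lemma nn_integral_lborel_shear:
  fixes i j :: "'a::euclidean_space"
  assumes i: "i \<in> Basis" and j: "j \<in> Basis" and "i \<noteq> j"
    and [measurable]: "h \<in> borel_measurable borel"
  shows "(\<integral>\<^sup>+x. h (x + (x \<bullet> j) *\<^sub>R i) \<partial>lborel) = (\<integral>\<^sup>+x. h x \<partial>lborel)"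
proof -
  define T :: "('a \<Rightarrow> real) \<Rightarrow> 'a" where "T = (\<lambda>x. \<Sum>b\<in>Basis. x b *\<^sub>R b)"
  define I where "I = Basis - {i}"
  interpret product_sigma_finite "\<lambda>_::'a. lborel :: real measure" ..
  have I: "finite I" "i \<notin> I" "Basis = insert i I"
    using i by (auto simp: I_def)
  have T [measurable]: "T \<in> (\<Pi>\<^sub>M b\<in>Basis. lborel) \<rightarrow>\<^sub>M borel"
    unfolding T_def by measurable
  have lb: "(\<integral>\<^sup>+x. k x \<partial>lborel) = (\<integral>\<^sup>+x. (\<integral>\<^sup>+y. k (T (x(i := y))) \<partial>lborel) \<partial>(\<Pi>\<^sub>M b\<in>I. lborel))"
    if [measurable]: "k \<in> borel_measurable borel" for k :: "'a \<Rightarrow> ennreal"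
  proof -
    have "(\<integral>\<^sup>+x. k x \<partial>lborel) = (\<integral>\<^sup>+x. k (T x) \<partial>(\<Pi>\<^sub>M b\<in>Basis. lborel))"
      unfolding T_def lborel_eq_real by (subst lborel_def, subst nn_integral_distr) auto
    also have "\<dots> = (\<integral>\<^sup>+x. (\<integral>\<^sup>+y. k (T (x(i := y))) \<partial>lborel) \<partial>(\<Pi>\<^sub>M b\<in>I. lborel))"
      unfolding I(3) using I(1,2) by (subst product_nn_integral_insert) (auto simp flip: I(3))
    finally show ?thesis .
  qed
  have Tj: "T x \<bullet> j = x j" for x
    using j by (simp add: T_def)
  \<comment> \<open>The factor \<open>1\<close> puts the shift in the form \<open>t + c * y\<close>
    that \<open>nn_integral_real_affine\<close> expects.\<close>
  have Ti: "T (x(i := y)) + c *\<^sub>R i = T (x(i := c + 1 * y))" for x y c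
  proof -
    have "(\<Sum>b\<in>I. (x(i := y)) b *\<^sub>R b) = (\<Sum>b\<in>I. (x(i := c + 1 * y)) b *\<^sub>R b)"
      using I(2) by (intro sum.cong) auto
    then show ?thesis
      using I(1,2) by (simp add: T_def I(3) scaleR_left_distrib)
  qed
  have "(\<integral>\<^sup>+x. h (x + (x \<bullet> j) *\<^sub>R i) \<partial>lborel)
      = (\<integral>\<^sup>+x. (\<integral>\<^sup>+y. h (T (x(i := x j + 1 * y))) \<partial>lborel) \<partial>(\<Pi>\<^sub>M b\<in>I. lborel))"
    using \<open>i \<noteq> j\<close> by (subst lb) (auto simp: Tj Ti)
  also have "\<dots> = (\<integral>\<^sup>+x. (\<integral>\<^sup>+y. h (T (x(i := y))) \<partial>lborel) \<partial>(\<Pi>\<^sub>M b\<in>I. lborel))"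
  proof (rule nn_integral_cong)
    fix x :: "'a \<Rightarrow> real"
    assume "x \<in> space (\<Pi>\<^sub>M b\<in>I. lborel)"
    then have [measurable]: "(\<lambda>y. x(i := y)) \<in> lborel \<rightarrow>\<^sub>M (\<Pi>\<^sub>M b\<in>Basis. lborel)"
      unfolding I(3) using I(2) by (intro measurable_fun_upd[where J=I]) auto
    show "(\<integral>\<^sup>+y. h (T (x(i := x j + 1 * y))) \<partial>lborel) = (\<integral>\<^sup>+y. h (T (x(i := y))) \<partial>lborel)"
      by (subst (2) nn_integral_real_affine[where c=1 and t="x j"]) auto
  qed
  also have "\<dots> = (\<integral>\<^sup>+x. h x \<partial>lborel)"
    by (subst lb) auto
  finally show ?thesis .
qed

lemma prod_Basis_cart: "prod k (Basis :: (real ^ 'n) set) = (\<Prod>i\<in>UNIV. k (axis i 1))"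
proof -
  have "inj (\<lambda>i::'n. axis i (1::real))"
    by (auto simp: inj_on_def axis_eq_axis)
  moreover have "Basis = range (\<lambda>i::'n. axis i (1::real))"
    by (auto simp: Basis_vec_def)
  ultimately show ?thesis
    using prod.reindex[of "\<lambda>i::'n. axis i (1::real)" UNIV k] by (simp only: o_def)
qed

lemma sum_Basis_cart: "sum k (Basis :: (real ^ 'n) set) = (\<Sum>i\<in>UNIV. k (axis i 1))"
proof -
  have "inj (\<lambda>i::'n. axis i (1::real))"
    by (auto simp: inj_on_def axis_eq_axis)
  moreover have "Basis = range (\<lambda>i::'n. axis i (1::real))"
    by (auto simp: Basis_vec_def)
  ultimately show ?thesis
    using sum.reindex[of "\<lambda>i::'n. axis i (1::real)" UNIV k] by (simp only: o_def)
qed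

text \<open>The linear change of variables in \<^theory>\<open>HOL-Analysis.Change_Of_Vars\<close> assumes a well-ordered
  index type.\<close>

lemma nn_integral_lborel_linear:
  fixes T :: "real ^ 'n \<Rightarrow> real ^ 'n"
  assumes "linear T" and "det (matrix T) \<noteq> 0" and "h \<in> borel_measurable borel"
  shows "(\<integral>\<^sup>+x. h x \<partial>lborel) = ennreal \<bar>det (matrix T)\<bar> * (\<integral>\<^sup>+x. h (T x) \<partial>lborel)"
proof -
  \<comment> \<open>A predicate on maps fits the induction over elementary linear maps. Linearity
    and invertibility sit inside it, so singular maps satisfy it vacuously; \<open>h\<close> is
    quantified because a composition \<open>f \<circ> g\<close> uses the claim for \<open>g\<close>
    at \<open>h\<close> pulled back along \<open>f\<close>.\<close>
  define P where "P T \<longleftrightarrow> (linear T \<longrightarrow> det (matrix T) \<noteq> 0 \<longrightarrow>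
      (\<forall>h\<in>borel_measurable borel. (\<integral>\<^sup>+x. h x \<partial>lborel) =
        ennreal \<bar>det (matrix T)\<bar> * (\<integral>\<^sup>+x. h (T x) \<partial>lborel)))" for T :: "real ^ 'n \<Rightarrow> real ^ 'n"
  have borel_linear: "T \<in> borel_measurable borel" if "linear T" for T :: "real ^ 'n \<Rightarrow> real ^ 'n"
    using that linear_continuous_on[of T] by (auto intro!: borel_measurable_continuous_onI simp: linear_linear)
  have PI: "P T" if "\<And>h. linear T \<Longrightarrow> det (matrix T) \<noteq> 0 \<Longrightarrow> h \<in> borel_measurable borel \<Longrightarrow>
      (\<integral>\<^sup>+x. h x \<partial>lborel) = ennreal \<bar>det (matrix T)\<bar> * (\<integral>\<^sup>+x. h (T x) \<partial>lborel)"
    for T :: "real ^ 'n \<Rightarrow> real ^ 'n"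
    unfolding P_def using that by blast
  have PD: "(\<integral>\<^sup>+x. h x \<partial>lborel) = ennreal \<bar>det (matrix T)\<bar> * (\<integral>\<^sup>+x. h (T x) \<partial>lborel)"
    if "P T" "linear T" "det (matrix T) \<noteq> 0" "h \<in> borel_measurable borel"
    for T :: "real ^ 'n \<Rightarrow> real ^ 'n" and h
    using that unfolding P_def by blast
  have "P T"
    using \<open>linear T\<close>
  proof (rule induct_linear_elementary)
    fix f g :: "real ^ 'n \<Rightarrow> real ^ 'n"
    assume lin: "linear f" "linear g" and "P f" "P g"
    have [measurable]: "f \<in> borel_measurable borel"
      by (rule borel_linear[OF lin(1)])
    have det: "det (matrix (f \<circ> g)) = det (matrix f) * det (matrix g)"
      using lin by (simp add: matrix_compose det_mul)
    show "P (f \<circ> g)"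
    proof (rule PI)
      fix h :: "real ^ 'n \<Rightarrow> ennreal"
      assume nz: "det (matrix (f \<circ> g)) \<noteq> 0" and [measurable]: "h \<in> borel_measurable borel"
      have "(\<integral>\<^sup>+x. h x \<partial>lborel) = ennreal \<bar>det (matrix f)\<bar> * (\<integral>\<^sup>+x. h (f x) \<partial>lborel)"
        using nz by (intro PD[OF \<open>P f\<close> lin(1)]) (auto simp: det)
      also have "(\<integral>\<^sup>+x. h (f x) \<partial>lborel) = ennreal \<bar>det (matrix g)\<bar> * (\<integral>\<^sup>+x. h (f (g x)) \<partial>lborel)"
      proof -
        have "(\<lambda>x. h (f x)) \<in> borel_measurable borel"
          by measurable
        then show ?thesis
          using nz by (intro PD[OF \<open>P g\<close> lin(2)]) (auto simp: det)
      qed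
      finally show "(\<integral>\<^sup>+x. h x \<partial>lborel) =
          ennreal \<bar>det (matrix (f \<circ> g))\<bar> * (\<integral>\<^sup>+x. h ((f \<circ> g) x) \<partial>lborel)"
        by (simp add: det abs_mult ennreal_mult mult.assoc)
    qed
  next
    fix f :: "real ^ 'n \<Rightarrow> real ^ 'n" and i
    assume "linear f" and "\<And>x. f x $ i = 0"
    \<comment> \<open>A coordinate that vanishes identically gives a zero row, so the determinant is
      0 and \<open>P f\<close> is vacuous.\<close>
    then have "row i (matrix f) = 0"
      by (simp add: matrix_def row_def vec_eq_iff)
    then show "P f"
      by (intro PI) (simp add: det_zero_row)
  next
    fix c :: "'n \<Rightarrow> real"
    let ?T = "\<lambda>x::real ^ 'n. \<chi> i. c i * x $ i"
    have "matrix ?T $ i $ j = 0" if "i \<noteq> j" for i j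
      using that by (simp add: matrix_def axis_def)
    then have det: "det (matrix ?T) = prod c UNIV"
      by (subst det_diagonal) (auto simp: matrix_def axis_def)
    \<comment> \<open>\<open>lborel_affine_euclidean\<close> takes one scaling factor per basis
      vector, so \<open>d\<close> goes back from a basis vector to its index, which is
      unique.\<close>
    define d where "d b = c (SOME i. b = axis i 1)" for b :: "real ^ 'n"
    have d: "d (axis i 1) = c i" for i
    proof -
      have "(SOME k. axis i (1::real) = axis k 1) = i"
        by (rule some_equality) (auto simp: axis_eq_axis)
      then show ?thesis
        by (simp add: d_def)
    qed
    have Basis: "Basis = range (\<lambda>i::'n. axis i (1::real))"
      by (auto simp: Basis_vec_def)
    have T: "?T x = 0 + (\<Sum>b\<in>Basis. (d b * (x \<bullet> b)) *\<^sub>R b)" for x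
      by (simp add: sum_Basis_cart d inner_axis)
        (simp add: vec_eq_iff axis_def if_distrib[of "\<lambda>y. _ * y"] sum.delta cong: if_cong)
    show "P ?T"
    proof (rule PI, unfold det)
      fix h :: "real ^ 'n \<Rightarrow> ennreal"
      assume lin: "linear ?T" and nz: "prod c UNIV \<noteq> 0" and [measurable]: "h \<in> borel_measurable borel"
      have [measurable]: "?T \<in> borel_measurable borel"
        by (rule borel_linear[OF lin])
      have "lborel = density (distr lborel borel ?T) (\<lambda>_. \<Prod>b\<in>Basis. \<bar>d b\<bar>)"
        unfolding T by (rule lborel_affine_euclidean) (use nz in \<open>auto simp: Basis d\<close>)
      also have "(\<Prod>b\<in>Basis. \<bar>d b\<bar>) = \<bar>prod c UNIV\<bar>"
        by (simp add: prod_Basis_cart d abs_prod)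
      finally have "(\<integral>\<^sup>+x. h x \<partial>lborel)
          = (\<integral>\<^sup>+x. h x \<partial>density (distr lborel borel ?T) (\<lambda>_. ennreal \<bar>prod c UNIV\<bar>))"
        by simp
      then show "(\<integral>\<^sup>+x. h x \<partial>lborel) = ennreal \<bar>prod c UNIV\<bar> * (\<integral>\<^sup>+x. h (?T x) \<partial>lborel)"
        by (simp add: nn_integral_density nn_integral_distr nn_integral_cmult)
    qed
  next
    fix m n :: 'n
    assume "m \<noteq> n"
    let ?t = "Transposition.transpose m n"
    let ?T = "\<lambda>x::real ^ 'n. \<chi> i. x $ ?t i"
    have lin: "linear ?T"
      by (rule linearI) (auto simp: vec_eq_iff)
    have [measurable]: "?T \<in> borel_measurable borel"
      by (rule borel_linear[OF lin])
    have "matrix ?T = (\<chi> i. mat 1 $ ?t i)"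
      by (auto simp: matrix_def mat_def axis_def vec_eq_iff)
    then have det: "\<bar>det (matrix ?T)\<bar> = 1"
      by (simp add: det_permute_rows permutes_swap_id sign_swap_id abs_mult)
    \<comment> \<open>Swapping coordinates pulls a box back to the box with swapped corners, whose
      side lengths are merely permuted; the values on boxes determine \<open>lborel\<close>.\<close>
    have "lborel = distr lborel borel ?T"
    proof (rule lborel_eqI)
      fix l u :: "real ^ 'n"
      assume le: "\<And>b. b \<in> Basis \<Longrightarrow> l \<bullet> b \<le> u \<bullet> b"
      have le': "l $ i \<le> u $ i" for i
        using le[of "axis i 1"] by (simp add: inner_axis axis_in_Basis_iff)
      have "?T -` box l u = box (?T l) (?T u)"
        by (auto simp: mem_box_cart) (metis transpose_involutory)+
      then have "emeasure (distr lborel borel ?T) (box l u) = emeasure lborel (box (?T l) (?T u))"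
        by (simp add: emeasure_distr)
      also have "\<dots> = ennreal (\<Prod>i\<in>UNIV. (u - l) $ ?t i)"
      proof -
        have "?T l \<bullet> b \<le> ?T u \<bullet> b" if "b \<in> Basis" for b
          using that by (auto simp: Basis_vec_def inner_axis le')
        then show ?thesis
          by (subst emeasure_lborel_box) (simp_all add: prod_Basis_cart inner_axis)
      qed
      also have "(\<Prod>i\<in>UNIV. (u - l) $ ?t i) = (\<Prod>i\<in>UNIV. (u - l) $ i)"
        using prod.permute[OF permutes_swap_id[of m UNIV n], of "\<lambda>i. (u - l) $ i"]
        by (simp add: o_def)
      also have "\<dots> = (\<Prod>b\<in>Basis. (u - l) \<bullet> b)"
        by (simp add: prod_Basis_cart inner_axis)
      finally show "emeasure (distr lborel borel ?T) (box l u) = ennreal (\<Prod>b\<in>Basis. (u - l) \<bullet> b)" .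
    qed simp
    then have "(\<integral>\<^sup>+x. h x \<partial>lborel) = (\<integral>\<^sup>+x. h (?T x) \<partial>lborel)"
      if "h \<in> borel_measurable borel" for h :: "real ^ 'n \<Rightarrow> ennreal"
    proof -
      have [measurable]: "h \<in> borel_measurable borel"
        by fact
      have "(\<integral>\<^sup>+x. h x \<partial>lborel) = (\<integral>\<^sup>+x. h x \<partial>distr lborel borel ?T)"
        using \<open>lborel = distr lborel borel ?T\<close> by simp
      also have "\<dots> = (\<integral>\<^sup>+x. h (?T x) \<partial>lborel)"
        by (rule nn_integral_distr) auto
      finally show ?thesis .
    qed
    then show "P ?T"
      by (intro PI) (simp only: det ennreal_1 mult_1)
  next
    fix m n :: 'n
    assume "m \<noteq> n"
    let ?T = "\<lambda>x::real ^ 'n. \<chi> i. if i = m then x $ m + x $ n else x $ i"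
    have T: "?T x = x + (x \<bullet> axis n 1) *\<^sub>R axis m 1" for x
      by (simp add: inner_axis) (auto simp: vec_eq_iff axis_def)
    \<comment> \<open>The shear is the row operation that adds row \<open>n\<close> of the identity
      to row \<open>m\<close>, which preserves the determinant.\<close>
    have "matrix ?T = (\<chi> i. if i = m then row m (mat 1) + 1 *s row n (mat 1) else row i (mat 1))"
      using \<open>m \<noteq> n\<close> by (auto simp: matrix_def mat_def axis_def row_def vec_eq_iff)
    then have det: "det (matrix ?T) = 1"
      using \<open>m \<noteq> n\<close> by (simp add: det_row_operation)
    show "P ?T"
    proof (rule PI)
      fix h :: "real ^ 'n \<Rightarrow> ennreal"
      assume "h \<in> borel_measurable borel"
      then have "(\<integral>\<^sup>+x. h (x + (x \<bullet> axis n 1) *\<^sub>R axis m 1) \<partial>lborel) = (\<integral>\<^sup>+x. h x \<partial>lborel)"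
        using \<open>m \<noteq> n\<close> by (intro nn_integral_lborel_shear) (auto simp: axis_in_Basis_iff axis_eq_axis)
      then show "(\<integral>\<^sup>+x. h x \<partial>lborel) = ennreal \<bar>det (matrix ?T)\<bar> * (\<integral>\<^sup>+x. h (?T x) \<partial>lborel)"
        unfolding det unfolding T by simp
    qed
  qed
  then show ?thesis
    using assms by (rule PD)
qed

section \<open>Gaussian densities and standardisation of a covariance matrix\<close>

text \<open>The integrand is a product over the coordinates, so the integral factors; each factor is
  \<open>sqrt (2 * pi)\<close> because the standard normal density has mass 1.\<close>

lemma nn_integral_gaussian:
  "(\<integral>\<^sup>+(x::'a::euclidean_space). ennreal (exp (- (norm x)\<^sup>2 / 2)) \<partial>lborel)
    = ennreal ((2 * pi) powr (real DIM('a) / 2))"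
proof -
  have real: "(\<integral>\<^sup>+(t::real). ennreal (exp (- t\<^sup>2 / 2)) \<partial>lborel) = ennreal (sqrt (2 * pi))"
  proof -
    have "(\<integral>\<^sup>+t. ennreal (exp (- t\<^sup>2 / 2)) \<partial>lborel)
        = (\<integral>\<^sup>+t. ennreal (sqrt (2 * pi)) * ennreal (std_normal_density t) \<partial>lborel)"
      by (intro nn_integral_cong) (simp add: std_normal_density_def flip: ennreal_mult')
    also have "\<dots> = ennreal (sqrt (2 * pi))"
      by (simp add: nn_integral_cmult nn_integral_eq_integral)
    finally show ?thesis .
  qed
  have "(\<integral>\<^sup>+(x::'a). ennreal (exp (- (norm x)\<^sup>2 / 2)) \<partial>lborel)
      = (\<integral>\<^sup>+(x::'a). (\<Prod>b\<in>Basis. ennreal (exp (- (x \<bullet> b)\<^sup>2 / 2))) \<partial>lborel)"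
  proof (intro nn_integral_cong)
    fix x :: 'a
    have "(norm x)\<^sup>2 = (\<Sum>b\<in>Basis. (x \<bullet> b)\<^sup>2)"
      unfolding power2_norm_eq_inner by (subst euclidean_inner) (simp add: power2_eq_square)
    then have "exp (- (norm x)\<^sup>2 / 2) = (\<Prod>b\<in>Basis. exp (- (x \<bullet> b)\<^sup>2 / 2))"
      by (simp add: exp_sum[symmetric] sum_negf sum_divide_distrib)
    then show "ennreal (exp (- (norm x)\<^sup>2 / 2)) = (\<Prod>b\<in>Basis. ennreal (exp (- (x \<bullet> b)\<^sup>2 / 2)))"
      by (simp add: prod_ennreal)
  qed
  also have "\<dots> = ennreal (sqrt (2 * pi)) ^ DIM('a)"
    by (subst nn_integral_lborel_prod) (simp_all add: real[simplified])
  also have "\<dots> = ennreal ((2 * pi) powr (real DIM('a) / 2))"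
    by (simp add: ennreal_power powr_half_sqrt[symmetric] powr_powr flip: powr_realpow)
  finally show ?thesis .
qed

text \<open>\<open>\<phi>\<close> is the normal density with mean \<open>m\<close> and covariance
  matrix (A^T A)^(-1), which is S whenever A S A^T is the identity. Translation by \<open>m\<close>
  and then the substitution by \<open>A\<close> reduce its mass to the standard Gaussian
  integral.\<close>

lemma gaussian_density_cart:
  fixes A :: "real ^ 'n ^ 'n" and m :: "real ^ 'n"
  defines "\<phi> \<equiv> \<lambda>x. \<bar>det A\<bar> / (2 * pi) powr (real CARD('n) / 2) * exp (- (norm (A *v (x - m)))\<^sup>2 / 2)"
  assumes "det A \<noteq> 0"
  shows "integrable lebesgue \<phi>" and "(\<integral>x. \<phi> x \<partial>lebesgue) = 1"
proof -
  define c where "c = (2 * pi) powr (real CARD('n) / 2)"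
  have "c > 0"
    by (simp add: c_def)
  have "continuous_on UNIV ((*v) A)"
    by (rule linear_continuous_on) (simp add: matrix_vector_mul_bounded_linear)
  then have A [measurable]: "(*v) A \<in> borel_measurable borel"
    by (rule borel_measurable_continuous_onI)
  have [measurable]: "\<phi> \<in> borel_measurable borel"
    unfolding \<phi>_def by measurable
  let ?e = "\<lambda>y::real ^ 'n. ennreal (exp (- (norm y)\<^sup>2 / 2))"
  have "(\<integral>\<^sup>+x. \<phi> x \<partial>lborel) = (\<integral>\<^sup>+x. ennreal (\<bar>det A\<bar> / c) * ?e (A *v (- m + x)) \<partial>lborel)"
    using \<open>c > 0\<close> by (intro nn_integral_cong) (simp add: \<phi>_def c_def flip: ennreal_mult)
  also have "\<dots> = ennreal (\<bar>det A\<bar> / c) * (\<integral>\<^sup>+x. ?e (A *v (- m + x)) \<partial>lborel)"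
    by (rule nn_integral_cmult) measurable
  also have "(\<integral>\<^sup>+x. ?e (A *v (- m + x)) \<partial>lborel) = (\<integral>\<^sup>+x. ?e (A *v x) \<partial>distr lborel borel ((+) (- m)))"
    by (rule nn_integral_distr[symmetric]) measurable
  also have "distr lborel borel ((+) (- m)) = lborel"
    by (rule lborel_distr_plus)
  also have "ennreal (\<bar>det A\<bar> / c) * (\<integral>\<^sup>+x. ?e (A *v x) \<partial>lborel)
      = ennreal (1 / c) * (ennreal \<bar>det A\<bar> * (\<integral>\<^sup>+x. ?e (A *v x) \<partial>lborel))"
    using \<open>c > 0\<close> by (simp flip: ennreal_mult mult.assoc)
  also have "ennreal \<bar>det A\<bar> * (\<integral>\<^sup>+x. ?e (A *v x) \<partial>lborel) = (\<integral>\<^sup>+x. ?e x \<partial>lborel)"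
    using nn_integral_lborel_linear[of "(*v) A" ?e] \<open>det A \<noteq> 0\<close> by simp
  also have "\<dots> = ennreal c"
    using nn_integral_gaussian[where 'a="real ^ 'n"] by (simp add: c_def)
  also have "ennreal (1 / c) * ennreal c = 1"
    using \<open>c > 0\<close> by (simp flip: ennreal_mult)
  finally have nn: "(\<integral>\<^sup>+x. \<phi> x \<partial>lborel) = 1" .
  have pos: "\<phi> x \<ge> 0" for x
    by (simp add: \<phi>_def)
  have int: "integrable lborel \<phi>"
    by (rule integrableI_nonneg) (simp_all add: pos nn)
  then show "integrable lebesgue \<phi>"
    by (simp add: integrable_completion)
  have "(\<integral>x. \<phi> x \<partial>lborel) = 1"
    by (simp add: integral_eq_nn_integral pos nn)
  then show "(\<integral>x. \<phi> x \<partial>lebesgue) = 1"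
    by (simp add: integral_completion)
qed

text \<open>Gram--Schmidt for the inner product defined by \<open>S\<close>; the resulting basis forms the rows of \<open>A\<close>.\<close>

lemma positive_definite_congruent_identity:
  fixes S :: "real ^ 'n ^ 'n"
  assumes sym: "transpose S = S" and pos: "\<And>u. u \<noteq> 0 \<Longrightarrow> 0 < u \<bullet> (S *v u)"
  obtains A :: "real ^ 'n ^ 'n" where "A ** S ** transpose A = mat 1"
proof -
  have comm: "u \<bullet> (S *v v) = v \<bullet> (S *v u)" for u v
    by (metis dot_lmul_matrix inner_commute sym transpose_matrix_vector)
  have "\<exists>b. \<forall>i\<in>I. \<forall>j\<in>I. b i \<bullet> (S *v b j) = (if i = j then 1 else 0)" if "finite I" for I :: "'n set"
    using that
  proof (induction I)
    case empty
    then show ?case by simp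
  next
    case (insert k I)
    then obtain b where b: "b i \<bullet> (S *v b j) = (if i = j then 1 else 0)" if "i \<in> I" "j \<in> I" for i j
      by blast
    \<comment> \<open>Fewer than \<open>CARD('n)\<close> vectors cannot span the space, so some
      \<open>v\<close> lies outside their span.\<close>
    have "dim (b ` I) \<le> card I"
      using dim_le_card'[of "b ` I"] card_image_le[of I b] insert by simp
    also have "\<dots> < CARD('n)"
      using insert psubset_card_mono[of "UNIV :: 'n set" I] by auto
    finally have "dim (span (b ` I)) \<noteq> DIM(real ^ 'n)"
      by simp
    then have "span (b ` I) \<noteq> UNIV"
      by (metis dim_UNIV)
    then obtain v where v: "v \<notin> span (b ` I)"
      by blast
    \<comment> \<open>Removing from \<open>v\<close> its \<open>S\<close>-orthogonal projection onto
      the span leaves a nonzero vector that is \<open>S\<close>-orthogonal to all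
      \<open>b i\<close>; positivity of \<open>S\<close> then allows normalising it.\<close>
    define w where "w = v - (\<Sum>i\<in>I. (b i \<bullet> (S *v v)) *\<^sub>R b i)"
    have "(\<Sum>i\<in>I. (b i \<bullet> (S *v v)) *\<^sub>R b i) \<in> span (b ` I)"
      by (intro span_sum span_scale span_base) auto
    with v have "w \<noteq> 0"
      unfolding w_def by auto
    then have "0 < w \<bullet> (S *v w)"
      by (rule pos)
    have "w \<bullet> (S *v b j) = 0" if "j \<in> I" for j
    proof -
      have "w \<bullet> (S *v b j) = v \<bullet> (S *v b j) - (\<Sum>i\<in>I. (b i \<bullet> (S *v v)) * (b i \<bullet> (S *v b j)))"
        by (simp add: w_def inner_diff_left inner_sum_left)
      also have "(\<Sum>i\<in>I. (b i \<bullet> (S *v v)) * (b i \<bullet> (S *v b j))) = (\<Sum>i\<in>I. if i = j then b i \<bullet> (S *v v) else 0)"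
        using that by (intro sum.cong) (auto simp: b)
      also have "\<dots> = b j \<bullet> (S *v v)"
        using that insert by simp
      finally show ?thesis
        using comm[of v "b j"] by simp
    qed
    moreover from this have "b j \<bullet> (S *v w) = 0" if "j \<in> I" for j
      using that comm by metis
    moreover define u where "u = (1 / sqrt (w \<bullet> (S *v w))) *\<^sub>R w"
    moreover have "u \<bullet> (S *v u) = 1"
      using \<open>0 < w \<bullet> (S *v w)\<close> by (simp add: u_def matrix_vector_mult_scaleR)
    ultimately have "\<forall>i\<in>insert k I. \<forall>j\<in>insert k I.
        (b(k := u)) i \<bullet> (S *v (b(k := u)) j) = (if i = j then 1 else 0)"
      using insert b by (auto simp: u_def matrix_vector_mult_scaleR)
    then show ?case
      by blast
  qed
  from this[of UNIV] obtain b :: "'n \<Rightarrow> real ^ 'n"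
    where b: "\<And>i j. b i \<bullet> (S *v b j) = (if i = j then 1 else 0)"
    by auto
  \<comment> \<open>The entries of the triple product are the values of the form \<open>S\<close> on
    pairs of rows.\<close>
  have "(vec_lambda b ** S ** transpose (vec_lambda b)) $ i $ j = b i \<bullet> (S *v b j)" for i j
  proof -
    have "(vec_lambda b ** S ** transpose (vec_lambda b)) $ i $ j = (b i v* S) \<bullet> b j"
      by (simp add: matrix_matrix_mult_def transpose_def inner_vec_def vector_matrix_mult_def mult.commute)
    then show ?thesis
      by (simp add: dot_lmul_matrix)
  qed
  then have "vec_lambda b ** S ** transpose (vec_lambda b) = mat 1"
    by (simp add: vec_eq_iff mat_def b)
  then show ?thesis
    by (rule that)
qed

section \<open>Lower bound for the integral of \<open>g powr (1 + s)\<close> by comparison with a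
  Gaussian\<close>

text \<open>The right-hand side integrates only the positive part of \<open>f\<close>. This turns a
  pointwise lower bound that may be negative into a bound between nonnegative integrals.\<close>

lemma ennreal_integral_le_nn_integral:
  fixes f :: "'a \<Rightarrow> real"
  assumes "integrable M f"
  shows "ennreal (\<integral>x. f x \<partial>M) \<le> (\<integral>\<^sup>+x. ennreal (f x) \<partial>M)"
proof -
  have fin: "(\<integral>\<^sup>+x. ennreal (f x) \<partial>M) < \<infinity>"
    using assms by (simp add: real_integrable_def top.not_eq_extremum)
  have "(\<integral>x. f x \<partial>M) \<le> enn2real (\<integral>\<^sup>+x. ennreal (f x) \<partial>M)"
    by (simp add: real_lebesgue_integral_def[OF assms])
  then have "ennreal (\<integral>x. f x \<partial>M) \<le> ennreal (enn2real (\<integral>\<^sup>+x. ennreal (f x) \<partial>M))"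
    by (rule ennreal_leI)
  then show ?thesis
    using ennreal_enn2real[OF fin[unfolded infinity_ennreal_def]] by (simp only:)
qed

text \<open>Combines \<open>ln (\<phi> / g) \<le> \<phi> / g - 1\<close> with the tangent line of \<open>exp\<close> at \<open>0\<close>, evaluated at
  \<open>s (ln g + K)\<close>.\<close>

lemma powr_gibbs_bound:
  fixes g \<phi> s K :: real
  assumes "0 \<le> g" "0 < \<phi>" "0 < s"
  shows "exp (- s * K) * (g + s * (g * (ln \<phi> + 1 + K) - \<phi>)) \<le> g powr (1 + s)"
\<comment> \<open>For \<open>g = 0\<close> the left-hand side is a negative multiple of
  \<open>\<phi>\<close>, while \<open>0 powr (1 + s)\<close> is 0.\<close>
proof (cases "g = 0")
  case True
  then show ?thesis
    using assms by (simp add: mult_nonneg_nonneg)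
next
  case False
  with assms have "g > 0" by simp
  have "ln (\<phi> / g) \<le> \<phi> / g - 1"
    using \<open>g > 0\<close> assms by (intro ln_le_minus_one) simp
  then have "ln \<phi> + 1 - \<phi> / g \<le> ln g"
    using \<open>g > 0\<close> assms by (simp add: ln_div)
  then have "1 + s * (ln \<phi> + 1 - \<phi> / g + K) \<le> 1 + s * (ln g + K)"
    using \<open>0 < s\<close> by simp
  also have "\<dots> \<le> exp (s * (ln g + K))"
    by (rule exp_ge_add_one_self)
  finally have "exp (- s * K) * (g * (1 + s * (ln \<phi> + 1 - \<phi> / g + K))) \<le> exp (- s * K) * (g * exp (s * (ln g + K)))"
    using \<open>g > 0\<close> by (intro mult_left_mono) auto
  also have "exp (- s * K) * (g * exp (s * (ln g + K))) = g powr (1 + s)"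
    using \<open>g > 0\<close> by (simp add: powr_add) (simp add: powr_def flip: exp_add, simp add: algebra_simps)
  also have "g * (1 + s * (ln \<phi> + 1 - \<phi> / g + K)) = g + s * (g * (ln \<phi> + 1 + K) - \<phi>)"
    using \<open>g > 0\<close> by (simp add: field_simps)
  finally show ?thesis .
qed

text \<open>\<open>K\<close> is the differential entropy of the Gaussian with covariance matrix
  \<open>S\<close>. Integrate \<open>powr_gibbs_bound\<close> with \<open>\<phi>\<close> the density
  of that Gaussian centred at \<open>m\<close>: since \<open>ln \<phi>\<close> is quadratic, the
  integral of \<open>g * ln \<phi>\<close> depends only on the mass and second moments of
  \<open>g\<close> and equals \<open>- K\<close>. As \<open>\<phi>\<close> has mass 1, exactly
  \<open>exp (- s * K)\<close> remains.\<close>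

lemma powr_integral_ge_det:
  fixes g :: "real ^ 'n \<Rightarrow> real" and S :: "real ^ 'n ^ 'n" and m :: "real ^ 'n"
  defines "K \<equiv> 1 / 2 * ln (det S) + real CARD('n) / 2 * ln (2 * pi * exp 1)"
  assumes nonneg: "\<And>x. 0 \<le> g x"
    and int: "integrable lebesgue g" and one: "(\<integral>x. g x \<partial>lebesgue) = 1"
    and mom: "\<And>i j. integrable lebesgue (\<lambda>x. g x * ((x - m) $ i * (x - m) $ j))"
    and S: "\<And>i j. S $ i $ j = (\<integral>x. g x * ((x - m) $ i * (x - m) $ j) \<partial>lebesgue)"
    and "0 < s"
  shows "ennreal (exp (- s * K)) \<le> (\<integral>\<^sup>+x. ennreal (g x powr (1 + s)) \<partial>lebesgue)"
proof -
  have bilin: "integrable lebesgue (\<lambda>x. g x * ((u \<bullet> (x - m)) * (v \<bullet> (x - m))))"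
      "(\<integral>x. g x * ((u \<bullet> (x - m)) * (v \<bullet> (x - m))) \<partial>lebesgue) = u \<bullet> (S *v v)" for u v :: "real ^ 'n"
  proof -
    have eq: "g x * ((u \<bullet> (x - m)) * (v \<bullet> (x - m)))
        = (\<Sum>i\<in>UNIV. \<Sum>j\<in>UNIV. u $ i * v $ j * (g x * ((x - m) $ i * (x - m) $ j)))" for x
      unfolding inner_vec_def sum_product unfolding sum_distrib_left by (intro sum.cong refl) (simp add: mult_ac)
    show "integrable lebesgue (\<lambda>x. g x * ((u \<bullet> (x - m)) * (v \<bullet> (x - m))))"
      unfolding eq by (intro Bochner_Integration.integrable_sum integrable_mult_right mom)
    have "(\<integral>x. g x * ((u \<bullet> (x - m)) * (v \<bullet> (x - m))) \<partial>lebesgue) = (\<Sum>i\<in>UNIV. \<Sum>j\<in>UNIV. u $ i * v $ j * S $ i $ j)"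
      unfolding eq S by (simp add: mom del: vector_minus_component)
    also have "\<dots> = u \<bullet> (S *v v)"
      by (simp add: inner_vec_def matrix_vector_mult_def sum_distrib_left mult_ac)
    finally show "(\<integral>x. g x * ((u \<bullet> (x - m)) * (v \<bullet> (x - m))) \<partial>lebesgue) = u \<bullet> (S *v v)" .
  qed
  \<comment> \<open>If the form vanished at some \<open>u \<noteq> 0\<close>, then \<open>g\<close>
    would vanish almost everywhere off the hyperplane through \<open>m\<close> orthogonal to
    \<open>u\<close>. That hyperplane is a null set, so \<open>g\<close> could not have mass
    1.\<close>
  have pos: "0 < u \<bullet> (S *v u)" if "u \<noteq> 0" for u
  proof -
    have nn: "0 \<le> g x * ((u \<bullet> (x - m)) * (u \<bullet> (x - m)))" for x
      by (simp add: nonneg)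
    have "u \<bullet> (S *v u) \<noteq> 0"
    proof
      assume "u \<bullet> (S *v u) = 0"
      then have "AE x in lebesgue. g x * ((u \<bullet> (x - m)) * (u \<bullet> (x - m))) = 0"
        using integral_nonneg_eq_0_iff_AE[OF bilin(1)[of u u]] nn bilin(2)[of u u] by simp
      moreover have "AE x in lebesgue. x \<notin> {x. u \<bullet> x = u \<bullet> m}"
        using negligible_hyperplane[of u "u \<bullet> m"] that AE_not_in by (metis negligible_iff_null_sets)
      ultimately have "AE x in lebesgue. g x = 0"
        by eventually_elim (auto simp: inner_diff_right)
      then have "(\<integral>x. g x \<partial>lebesgue) = 0"
        by (rule integral_eq_zero_AE)
      with one show False by simp
    qed
    moreover have "0 \<le> u \<bullet> (S *v u)"
      unfolding bilin(2)[symmetric] by (rule Bochner_Integration.integral_nonneg) (rule nn)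
    ultimately show ?thesis by simp
  qed
  have sym: "transpose S = S"
    by (simp add: vec_eq_iff transpose_def S mult.commute)
  obtain A :: "real ^ 'n ^ 'n" where A: "A ** S ** transpose A = mat 1"
    using positive_definite_congruent_identity[OF sym pos] by metis
  \<comment> \<open>Taking determinants shows \<open>det S > 0\<close> and expresses
    \<open>ln \<bar>det A\<bar>\<close>, which enters the Gaussian's normalising constant, through
    \<open>det S\<close>.\<close>
  then have "det (A ** S ** transpose A) = 1"
    by simp
  then have detA: "(det A)\<^sup>2 * det S = 1"
    by (simp add: det_mul det_transpose power2_eq_square mult_ac)
  then have "det A \<noteq> 0"
    by auto
  with detA have "det S > 0"
    using zero_less_mult_pos[of "(det A)\<^sup>2" "det S"] by simp
  have ln_detA: "ln \<bar>det A\<bar> = - ln (det S) / 2"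
  proof -
    have "2 * ln \<bar>det A\<bar> + ln (det S) = ln (\<bar>det A\<bar>\<^sup>2 * det S)"
      using \<open>det A \<noteq> 0\<close> \<open>det S > 0\<close> by (simp only: ln_mult ln_realpow) (simp add: ln_mult ln_realpow)
    then show ?thesis
      using detA by simp
  qed
  define c where "c = \<bar>det A\<bar> / (2 * pi) powr (real CARD('n) / 2)"
  define \<phi> where "\<phi> = (\<lambda>x. c * exp (- (norm (A *v (x - m)))\<^sup>2 / 2))"
  have "c > 0"
    using \<open>det A \<noteq> 0\<close> by (simp add: c_def)
  \<comment> \<open>The summand \<open>CARD('n) / 2\<close> compensates the factor
    \<open>exp 1\<close> inside \<open>K\<close>.\<close>
  have ln_c: "ln c = real CARD('n) / 2 - K"
    using \<open>det A \<noteq> 0\<close> by (simp add: c_def K_def ln_div ln_powr ln_mult ln_detA field_simps)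
  have \<phi>: "integrable lebesgue \<phi>" "(\<integral>x. \<phi> x \<partial>lebesgue) = 1"
    unfolding \<phi>_def c_def by (rule gaussian_density_cart[OF \<open>det A \<noteq> 0\<close>])+
  \<comment> \<open>The rows of \<open>A\<close> are \<open>S\<close>-orthonormal, so each
    contributes 1 to the integral of the quadratic form, in total the trace of the identity.\<close>
  have quad_eq: "g x * (norm (A *v (x - m)))\<^sup>2
      = (\<Sum>i\<in>UNIV. g x * ((A $ i \<bullet> (x - m)) * (A $ i \<bullet> (x - m))))" for x
    by (simp add: power2_norm_eq_inner inner_vec_def[of "A *v _"] matrix_vector_mult_def
        inner_vec_def sum_distrib_left)
  have quad: "integrable lebesgue (\<lambda>x. g x * (norm (A *v (x - m)))\<^sup>2)"
      "(\<integral>x. g x * (norm (A *v (x - m)))\<^sup>2 \<partial>lebesgue) = real CARD('n)"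
  proof -
    show "integrable lebesgue (\<lambda>x. g x * (norm (A *v (x - m)))\<^sup>2)"
      unfolding quad_eq by (intro Bochner_Integration.integrable_sum bilin)
    have "A $ i \<bullet> (S *v A $ i) = (A ** S ** transpose A) $ i $ i" for i
      unfolding dot_lmul_matrix[symmetric]
      by (simp add: matrix_matrix_mult_def transpose_def inner_vec_def vector_matrix_mult_def mult.commute)
    then show "(\<integral>x. g x * (norm (A *v (x - m)))\<^sup>2 \<partial>lebesgue) = real CARD('n)"
      unfolding quad_eq by (simp add: bilin A mat_def)
  qed
  \<comment> \<open>\<open>F\<close> is the left-hand side of \<open>powr_gibbs_bound\<close> at
    \<open>x\<close>; \<open>F_eq\<close> exhibits it as a linear combination of three integrable
    functions.\<close>
  define F where "F x = exp (- s * K) * (g x + s * (g x * (ln (\<phi> x) + 1 + K) - \<phi> x))" for x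
  have F_eq: "F x = exp (- s * K) * ((1 + s * (ln c + 1 + K)) * g x
      - s / 2 * (g x * (norm (A *v (x - m)))\<^sup>2) - s * \<phi> x)" for x
  proof -
    have "ln (\<phi> x) = ln c - (norm (A *v (x - m)))\<^sup>2 / 2"
      using \<open>c > 0\<close> by (simp add: \<phi>_def ln_mult)
    then show ?thesis
      unfolding F_def by (simp only:) (simp add: algebra_simps)
  qed
  have "integrable lebesgue F"
    unfolding F_eq by (intro integrable_mult_right Bochner_Integration.integrable_diff int quad(1) \<phi>(1))
  have "(\<integral>x. F x \<partial>lebesgue) = exp (- s * K) * ((1 + s * (ln c + 1 + K)) - s / 2 * real CARD('n) - s)"
    unfolding F_eq by (simp add: int quad \<phi> one del: times_divide_eq_left)
  also have "\<dots> = exp (- s * K)"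
    by (simp add: ln_c field_simps)
  finally have "ennreal (exp (- s * K)) = ennreal (\<integral>x. F x \<partial>lebesgue)"
    by simp
  also have "\<dots> \<le> (\<integral>\<^sup>+x. ennreal (F x) \<partial>lebesgue)"
    by (rule ennreal_integral_le_nn_integral) fact
  also have "\<dots> \<le> (\<integral>\<^sup>+x. ennreal (g x powr (1 + s)) \<partial>lebesgue)"
    unfolding F_def using \<open>c > 0\<close> \<open>0 < s\<close>
    by (intro nn_integral_mono ennreal_leI powr_gibbs_bound) (auto simp: \<phi>_def nonneg)
  finally show ?thesis .
qed

section \<open>Second moments of \<open>\<bar>f\<bar> powr q\<close> and passage to the norms of
  \<open>f\<close>\<close>

text \<open>Each entry is at most |x - m|^2 \<le> 2 |x|^2 + 2 |m|^2 in absolute value, and the norm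
  of a matrix is at most the sum of its absolute entries. Hence the moments of order 0 and 2 about
  the origin dominate.\<close>

lemma integrable_second_moment:
  fixes w :: "real ^ 'n \<Rightarrow> real"
  assumes w: "integrable lebesgue w" and w2: "integrable lebesgue (\<lambda>x. (norm x)\<^sup>2 * w x)"
    and nonneg: "\<And>x. 0 \<le> w x"
  shows "integrable lebesgue (\<lambda>x. w x *\<^sub>R (\<chi> i j. (x - m) $ i * (x - m) $ j :: real ^ 'n ^ 'n))"
proof (rule Bochner_Integration.integrable_bound)
  let ?B = "\<lambda>x. real CARD('n) * (real CARD('n) * (2 * ((norm x)\<^sup>2 * w x) + 2 * (norm m)\<^sup>2 * w x))"
  show "integrable lebesgue ?B"
    using w w2 by auto
  have "continuous_on UNIV (\<lambda>x. (\<chi> i j. (x - m) $ i * (x - m) $ j) :: real ^ 'n ^ 'n)"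
    by (intro continuous_on_vec_lambda continuous_intros)
  then have "(\<lambda>x. (\<chi> i j. (x - m) $ i * (x - m) $ j) :: real ^ 'n ^ 'n) \<in> borel_measurable lebesgue"
    by (intro measurable_completion) (simp add: borel_measurable_continuous_onI)
  then show "(\<lambda>x. w x *\<^sub>R (\<chi> i j. (x - m) $ i * (x - m) $ j :: real ^ 'n ^ 'n)) \<in> borel_measurable lebesgue"
    using w by (intro borel_measurable_scaleR) auto
  show "AE x in lebesgue. norm (w x *\<^sub>R (\<chi> i j. (x - m) $ i * (x - m) $ j :: real ^ 'n ^ 'n)) \<le> norm (?B x)"
  proof (intro AE_I2)
    fix x :: "real ^ 'n"
    have entry: "\<bar>(x - m) $ i * (x - m) $ j\<bar> \<le> 2 * (norm x)\<^sup>2 + 2 * (norm m)\<^sup>2" for i j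
    proof -
      have "\<bar>(x - m) $ i * (x - m) $ j\<bar> \<le> norm (x - m) * norm (x - m)"
        unfolding abs_mult by (intro mult_mono component_le_norm_cart) auto
      also have "\<dots> \<le> (norm x + norm m) * (norm x + norm m)"
        by (intro mult_mono norm_triangle_ineq4) auto
      also have "\<dots> \<le> 2 * (norm x)\<^sup>2 + 2 * (norm m)\<^sup>2"
        using sum_squares_bound[of "norm x" "norm m"] by (simp add: power2_eq_square algebra_simps)
      finally show ?thesis .
    qed
    have "norm ((\<chi> i j. (x - m) $ i * (x - m) $ j) :: real ^ 'n ^ 'n)
        \<le> (\<Sum>i\<in>UNIV. norm (\<chi> j::'n. (x - m) $ i * (x - m) $ j))"
      by (subst norm_vec_def) (simp add: L2_set_le_sum)
    also have "\<dots> \<le> (\<Sum>i\<in>(UNIV::'n set). \<Sum>j\<in>(UNIV::'n set). \<bar>(x - m) $ i * (x - m) $ j\<bar>)"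
      by (intro sum_mono order_trans[OF norm_le_l1_cart]) simp
    also have "\<dots> \<le> (\<Sum>i\<in>(UNIV::'n set). \<Sum>j\<in>(UNIV::'n set). 2 * (norm x)\<^sup>2 + 2 * (norm m)\<^sup>2)"
      by (intro sum_mono entry)
    finally have "w x * norm ((\<chi> i j. (x - m) $ i * (x - m) $ j) :: real ^ 'n ^ 'n)
        \<le> w x * (real CARD('n) * (real CARD('n) * (2 * (norm x)\<^sup>2 + 2 * (norm m)\<^sup>2)))"
      by (intro mult_left_mono nonneg) simp
    also have "\<dots> = ?B x"
      by (simp add: algebra_simps)
    also have "\<dots> \<le> norm (?B x)"
      by simp
    finally show "norm (w x *\<^sub>R (\<chi> i j. (x - m) $ i * (x - m) $ j :: real ^ 'n ^ 'n)) \<le> norm (?B x)"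
      by (simp add: nonneg)
  qed
qed

lemma ext_log_ennreal: "0 < a \<Longrightarrow> ext_log (ennreal a) = ereal (ln a)"
  by (simp add: ext_log_def ennreal_eq_0_iff)

lemma Lp_norm_eq:
  assumes "(\<integral>\<^sup>+ x. ennreal (\<bar>f x\<bar> powr p) \<partial>lebesgue) = ennreal I" "0 \<le> I"
  shows "Lp_norm (ereal p) f = ennreal (I powr (1 / p))"
  using assms by (simp add: Lp_norm_def)

theorem corollary2:
  fixes f :: "real ^ 'n \<Rightarrow> real" and q :: real and r :: ereal and C :: real
  defines "C \<equiv> (2 * pi * exp 1) powr (real CARD('n) / 2)"
  assumes "0 < q" and "ereal q < r"
    and "prob_density f"
    and "Lp_norm (ereal q) f < \<infinity>"
    and "finite_q_covariance q f"
  shows "scaled_renyi_entropy (ereal q) f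
           \<le> scaled_renyi_entropy r f
              + (1 / ereal q - 1 / r) * ereal (1 / 2 * ln (det (q_covariance q f)) + ln C)"
proof -
  define w where "w x = \<bar>f x\<bar> powr q" for x
  define Z where "Z = (\<integral>x. w x \<partial>lebesgue)"
  define g where "g = (\<lambda>x. w x / Z)"
  define m where "m = q_expectation q f (\<lambda>x. x)"
  define S where "S = q_covariance q f"
  define K where "K = 1 / 2 * ln (det S) + real CARD('n) / 2 * ln (2 * pi * exp 1)"
  have f [measurable]: "f \<in> borel_measurable lebesgue"
    using \<open>prob_density f\<close> by (simp add: prob_density_def)
  have w_meas [measurable]: "w \<in> borel_measurable lebesgue"
    unfolding w_def by measurable
  \<comment> \<open>This yields \<open>Z > 0\<close> below and, for \<open>r = \<infinity>\<close>,
    a positive essential supremum, so that both logarithms are finite.\<close>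
  have f_nz: "\<not> (AE x in lebesgue. f x = 0)"
  proof
    assume "AE x in lebesgue. f x = 0"
    then have "(\<integral>\<^sup>+ x. ennreal (f x) \<partial>lebesgue) = 0"
      by (subst nn_integral_0_iff_AE) auto
    then show False
      using \<open>prob_density f\<close> by (simp add: prob_density_def)
  qed
  have w: "integrable lebesgue w"
  proof (rule integrableI_nonneg)
    show "(\<integral>\<^sup>+ x. ennreal (w x) \<partial>lebesgue) < \<infinity>"
      using \<open>Lp_norm (ereal q) f < \<infinity>\<close> by (auto simp: Lp_norm_def w_def Let_def top.not_eq_extremum split: if_splits)
  qed (auto simp: w_def)
  have "Z \<noteq> 0"
  proof
    assume "Z = 0"
    then have "AE x in lebesgue. w x = 0"
      using integral_nonneg_eq_0_iff_AE[OF w] unfolding Z_def by (auto simp: w_def)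
    with f_nz show False
      by (simp add: w_def)
  qed
  moreover have "Z \<ge> 0"
    unfolding Z_def by (rule Bochner_Integration.integral_nonneg) (simp add: w_def)
  ultimately have "Z > 0" by simp
  have nn_w: "(\<integral>\<^sup>+ x. ennreal (w x) \<partial>lebesgue) = ennreal Z"
    unfolding Z_def by (rule nn_integral_eq_integral[OF w]) (simp add: w_def)
  have w2: "integrable lebesgue (\<lambda>x. (norm x)\<^sup>2 * w x)"
  proof (rule integrableI_nonneg)
    have "(\<lambda>x::real ^ 'n. (norm x)\<^sup>2) \<in> borel_measurable lebesgue"
      by (intro measurable_completion) simp
    then show "(\<lambda>x. (norm x)\<^sup>2 * w x) \<in> borel_measurable lebesgue"
      by measurable
    show "(\<integral>\<^sup>+ x. ennreal ((norm x)\<^sup>2 * w x) \<partial>lebesgue) < \<infinity>"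
      using \<open>finite_q_covariance q f\<close> by (simp add: finite_q_covariance_def w_def)
  qed (auto simp: w_def)
  let ?M = "\<lambda>x. w x *\<^sub>R (\<chi> i j. (x - m) $ i * (x - m) $ j :: real ^ 'n ^ 'n)"
  have M: "integrable lebesgue ?M"
    by (rule integrable_second_moment[OF w w2]) (simp add: w_def)
  \<comment> \<open>The matrix integral is read off entrywise by applying the bounded linear map
    \<open>vec_nth\<close> twice.\<close>
  have row: "integrable lebesgue (\<lambda>x. ?M x $ i)" for i
    by (rule integrable_bounded_linear[OF bounded_linear_vec_nth M])
  have entry: "integrable lebesgue (\<lambda>x. ?M x $ i $ j)" for i j
    by (rule integrable_bounded_linear[OF bounded_linear_vec_nth row])
  have S_M: "S = (\<integral>x. ?M x \<partial>lebesgue) /\<^sub>R Z"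
  proof -
    have "columnvector v ** transpose (columnvector v :: real ^ 1 ^ 'n) = (\<chi> i j. v $ i * v $ j)"
      for v :: "real ^ 'n"
      by (simp add: vec_eq_iff matrix_matrix_mult_def transpose_def columnvector_def)
    then show ?thesis
      by (simp add: S_def q_covariance_def Let_def q_expectation_def m_def Z_def w_def)
  qed
  have mom: "integrable lebesgue (\<lambda>x. g x * ((x - m) $ i * (x - m) $ j))" for i j
    using integrable_divide[OF entry[of i j], of Z] by (simp add: g_def)
  have S_entry: "S $ i $ j = (\<integral>x. g x * ((x - m) $ i * (x - m) $ j) \<partial>lebesgue)" for i j
  proof -
    have "(\<integral>x. ?M x $ i $ j \<partial>lebesgue) = (\<integral>x. ?M x \<partial>lebesgue) $ i $ j"
      by (simp only: integral_bounded_linear[OF bounded_linear_vec_nth row]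
          integral_bounded_linear[OF bounded_linear_vec_nth M])
    then have "S $ i $ j = (\<integral>x. ?M x $ i $ j \<partial>lebesgue) / Z"
      by (simp only: S_M vector_scaleR_component real_scaleR_def divide_inverse mult.commute)
    also have "\<dots> = (\<integral>x. ?M x $ i $ j / Z \<partial>lebesgue)"
      by simp
    finally show ?thesis
      by (simp add: g_def)
  qed
  have g: "integrable lebesgue g" "(\<integral>x. g x \<partial>lebesgue) = 1"
    using w \<open>Z > 0\<close> by (simp_all add: g_def Z_def)
  have nonneg: "0 \<le> g x" for x
    using \<open>Z > 0\<close> by (simp add: g_def w_def)
  have key: "ennreal (exp (- s * K)) \<le> (\<integral>\<^sup>+x. ennreal (g x powr (1 + s)) \<partial>lebesgue)" if "0 < s" for s
    unfolding K_def by (rule powr_integral_ge_det[OF nonneg g mom S_entry that])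
  \<comment> \<open>\<open>C\<close> is chosen so that the bracket in the claim is the Gaussian
    entropy \<open>K\<close>.\<close>
  have K: "1 / 2 * ln (det (q_covariance q f)) + ln C = K"
    by (simp add: K_def S_def C_def ln_powr)
  have lhs: "scaled_renyi_entropy (ereal q) f = ereal (ln Z / q)"
  proof -
    have "Lp_norm (ereal q) f = ennreal (Z powr (1 / q))"
      using nn_w \<open>Z > 0\<close> by (intro Lp_norm_eq) (simp_all add: w_def)
    then show ?thesis
      using \<open>Z > 0\<close> by (simp add: scaled_renyi_entropy_def ext_log_ennreal ln_powr)
  qed
  show ?thesis
  proof (cases r)
    case MInf
    with \<open>ereal q < r\<close> show ?thesis by simp
  next
    case PInf
    define M where "M = esssup lebesgue (\<lambda>x. ennreal \<bar>f x\<bar>)"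
    have M: "scaled_renyi_entropy r f = ext_log M"
      using PInf by (simp add: scaled_renyi_entropy_def Lp_norm_def M_def)
    have AE_M: "AE x in lebesgue. ennreal \<bar>f x\<bar> \<le> M"
      unfolding M_def by (rule esssup_AE)
    show ?thesis
    proof (cases M)
      \<comment> \<open>The right-hand side is \<open>\<infinity>\<close>, because the summand next
        to \<open>ext_log M\<close> is a real number.\<close>
      case top
      then show ?thesis
        using M PInf by (simp add: ext_log_def)
    next
      case (real b)
      have b: "AE x in lebesgue. \<bar>f x\<bar> \<le> b"
        using AE_M real by simp
      have "b \<noteq> 0"
      proof
        assume "b = 0"
        then have "AE x in lebesgue. f x = 0"
          using b by simp
        with f_nz show False by simp
      qed
      with real have "b > 0" by simp
      \<comment> \<open>With \<open>s = 1\<close> the integrand is \<open>g * g\<close>; bounding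
        one factor by \<open>b powr q / Z\<close> leaves the mass 1 of the other.\<close>
      have "ennreal (exp (- 1 * K)) \<le> (\<integral>\<^sup>+x. ennreal (g x powr (1 + 1)) \<partial>lebesgue)"
        by (rule key) simp
      also have "\<dots> \<le> (\<integral>\<^sup>+x. ennreal (b powr q / Z * g x) \<partial>lebesgue)"
        using b
      proof (intro nn_integral_mono_AE, eventually_elim)
        fix x
        assume "\<bar>f x\<bar> \<le> b"
        then have "g x \<le> b powr q / Z"
          using \<open>Z > 0\<close> \<open>0 < q\<close> by (simp add: g_def w_def divide_right_mono powr_mono2)
        then have "g x * g x \<le> b powr q / Z * g x"
          by (intro mult_right_mono nonneg)
        then show "ennreal (g x powr (1 + 1)) \<le> ennreal (b powr q / Z * g x)"
          using nonneg[of x] by (intro ennreal_leI) (simp add: power2_eq_square)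
      qed
      also have "\<dots> = ennreal (b powr q / Z)"
        using g nonneg \<open>Z > 0\<close> by (subst nn_integral_eq_integral) simp_all
      finally have "exp (- K) \<le> b powr q / Z"
        using \<open>Z > 0\<close> by (simp add: ennreal_le_iff)
      then have "- K \<le> ln (b powr q / Z)"
        using \<open>Z > 0\<close> \<open>b > 0\<close> by (simp add: ln_ge_iff)
      then have "ln Z \<le> q * ln b + K"
        using \<open>Z > 0\<close> \<open>b > 0\<close> by (simp add: ln_div ln_powr)
      then have "ln Z / q \<le> ln b + 1 / q * K"
        using \<open>0 < q\<close> by (simp add: field_simps)
      then show ?thesis
        unfolding K lhs M using real \<open>b > 0\<close> \<open>0 < q\<close> PInf by (simp add: ext_log_ennreal one_ereal_def)
    qed
  next
    case (real p)
    with \<open>ereal q < r\<close> \<open>0 < q\<close> have "q < p" "0 < p" by simp_all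
    \<comment> \<open>Here \<open>1 + s = p / q\<close>, so \<open>g powr (1 + s)\<close> is a
      multiple of \<open>\<bar>f\<bar> powr p\<close>.\<close>
    define s where "s = p / q - 1"
    have "s > 0"
      using \<open>q < p\<close> \<open>0 < q\<close> by (simp add: s_def)
    have "g x powr (1 + s) = \<bar>f x\<bar> powr p / Z powr (p / q)" for x
      using \<open>Z > 0\<close> \<open>0 < q\<close> by (simp add: g_def w_def s_def powr_divide powr_powr)
    then have key_p: "ennreal (exp (- s * K)) \<le> (\<integral>\<^sup>+x. ennreal (\<bar>f x\<bar> powr p / Z powr (p / q)) \<partial>lebesgue)"
      using key[OF \<open>s > 0\<close>] by simp
    show ?thesis
    proof (cases "\<integral>\<^sup>+x. ennreal (\<bar>f x\<bar> powr p) \<partial>lebesgue")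
      case top
      then show ?thesis
        using real \<open>0 < p\<close> by (simp add: scaled_renyi_entropy_def Lp_norm_def ext_log_def)
    next
      case (real I)
      have "(\<integral>\<^sup>+x. ennreal (\<bar>f x\<bar> powr p / Z powr (p / q)) \<partial>lebesgue)
          = (\<integral>\<^sup>+x. ennreal (\<bar>f x\<bar> powr p) * ennreal (1 / Z powr (p / q)) \<partial>lebesgue)"
        by (simp flip: ennreal_mult)
      also have "\<dots> = ennreal I * ennreal (1 / Z powr (p / q))"
        using real by (subst nn_integral_multc) simp_all
      finally have "exp (- s * K) \<le> I / Z powr (p / q)"
        using key_p real \<open>Z > 0\<close> by (simp add: ennreal_le_iff flip: ennreal_mult)
      \<comment> \<open>For \<open>I = 0\<close> the right-hand side would be 0, below the positive
        exponential.\<close>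
      moreover from this have "I > 0"
        using real \<open>Z > 0\<close> by (cases "I = 0") (auto simp: not_le)
      ultimately have "- s * K \<le> ln (I / Z powr (p / q))"
        using \<open>Z > 0\<close> by (simp add: ln_ge_iff)
      then have "- s * K \<le> ln I - p / q * ln Z"
        using \<open>Z > 0\<close> \<open>I > 0\<close> by (simp add: ln_div ln_powr)
      \<comment> \<open>Division by \<open>p\<close> produces the coefficient in the claim, as
        \<open>s / p = 1 / q - 1 / p\<close>.\<close>
      then have "(- s * K) / p \<le> (ln I - p / q * ln Z) / p"
        using \<open>0 < p\<close> by (intro divide_right_mono) auto
      then have "ln Z / q \<le> ln I / p + (1 / q - 1 / p) * K"
      proof -
        have "(- s * K) / p = - ((1 / q - 1 / p) * K)"
          using \<open>0 < p\<close> \<open>0 < q\<close> by (simp add: s_def field_simps)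
        moreover have "(ln I - p / q * ln Z) / p = ln I / p - ln Z / q"
          using \<open>0 < p\<close> \<open>0 < q\<close> by (simp add: field_simps)
        ultimately show ?thesis
          using \<open>(- s * K) / p \<le> (ln I - p / q * ln Z) / p\<close> by linarith
      qed
      moreover have "scaled_renyi_entropy r f = ereal (ln I / p)"
        using Lp_norm_eq[OF real(2,1)] \<open>I > 0\<close> \<open>r = ereal p\<close>
        by (simp add: scaled_renyi_entropy_def ext_log_ennreal ln_powr)
      ultimately show ?thesis
        unfolding K lhs using \<open>0 < p\<close> \<open>0 < q\<close> \<open>r = ereal p\<close> by (simp add: one_ereal_def)
    qed
  qed
qed

end
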